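(* Let $n\ge 2$ and suppose that $A\in \mathbf{M}_n(\mathbb{R})$ is nonsingular. Then $A$ is a full matrix and has the inverse cyclic property if and only if $A^{-1}$ is a bi-diagonal south-west (bdsw) matrix.
   Context: $\mathbf{M}_n(\mathbb{R})$ is the set of real $n\times n$ matrices. A full matrix is a matrix each of whose entries is nonzero. A matrix $A=(a_{ij})\in\mathbf{M}_n(\mathbb{R})$ with $a_{ii}\neq 0$ for all $1\le i\le n$ is said to have the inverse cyclic property (or is called an inverse cyclic matrix) if its entries satisfy all of the following: (i) $a_{ij}=\dfrac{a_{ik}a_{kj}}{a_{kk}}$ for all $i<k<j$; (ii) $a_{ij}=\dfrac{a_{in}a_{nj}}{a_{nn}}$ for all $j<i$ with $i\neq n$; (iii) $a_{nj}=\dfrac{a_{n1}a_{1j}}{a_{11}}$ for all $j<n$. A matrix $B=(b_{ij})\in\mathbf{M}_n(\mathbb{R})$ is called a bi-diagonal south-west matrix (bdsw, for short) if all the entries on the main diagonal ($b_{ii}$, $1\le i\le n$), on the superdiagonal ($b_{i,i+1}$, $1\le i\le n-1$), and the entry $b_{n1}$ in the south-west corner are nonzero, while all the other entries are zero. *)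

theory Defs
  imports
    Complex_Main
    "Jordan_Normal_Form.Gauss_Jordan_Elimination"
begin

text \<open>
  Rows and columns are indexed by \<open>0, ..., n - 1\<close>: the paper's index \<open>i\<close> is \<open>i - 1\<close> here, so the
  distinguished indices \<open>1\<close> and \<open>n\<close> become \<open>0\<close> and \<open>n - 1\<close>.
\<close>

definition full_matrix :: "nat \<Rightarrow> real mat \<Rightarrow> bool" where
  "full_matrix n A \<longleftrightarrow> A \<in> carrier_mat n n \<and> (\<forall>i<n. \<forall>j<n. A $$ (i, j) \<noteq> 0)"

definition inverse_cyclic :: "nat \<Rightarrow> real mat \<Rightarrow> bool" where
  "inverse_cyclic n A \<longleftrightarrow>
     A \<in> carrier_mat n n \<and>
     (\<forall>i<n. A $$ (i, i) \<noteq> 0) \<and>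
     (\<forall>i k j. i < k \<and> k < j \<and> j < n \<longrightarrow>
        A $$ (i, j) = A $$ (i, k) * A $$ (k, j) / A $$ (k, k)) \<and>
     (\<forall>i j. j < i \<and> i < n \<and> i \<noteq> n - 1 \<longrightarrow>
        A $$ (i, j) = A $$ (i, n - 1) * A $$ (n - 1, j) / A $$ (n - 1, n - 1)) \<and>
     (\<forall>j. j < n - 1 \<longrightarrow>
        A $$ (n - 1, j) = A $$ (n - 1, 0) * A $$ (0, j) / A $$ (0, 0))"

definition bdsw :: "nat \<Rightarrow> real mat \<Rightarrow> bool" where
  "bdsw n B \<longleftrightarrow>
     B \<in> carrier_mat n n \<and>
     (\<forall>i<n. B $$ (i, i) \<noteq> 0) \<and>
     (\<forall>i. i + 1 < n \<longrightarrow> B $$ (i, i + 1) \<noteq> 0) \<and>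
     B $$ (n - 1, 0) \<noteq> 0 \<and>
     (\<forall>i<n. \<forall>j<n. i \<noteq> j \<and> j \<noteq> i + 1 \<and> (i, j) \<noteq> (n - 1, 0) \<longrightarrow> B $$ (i, j) = 0)"

end

theory Submission
  imports Defs
begin

text \<open>
  Number the columns cyclically, so that column \<open>n - 1\<close> precedes column \<open>0\<close>. Both sides of the
  equivalence say the same thing about \<open>A\<close>: consecutive columns are proportional, with a nonzero
  factor, except in one row, namely column \<open>j\<close> is \<open>c j\<close> times the column before it outside of
  row \<open>j\<close>. This condition is \<open>cyclic_columns\<close> below.

  Read in the inverse \<open>B\<close>, it says that column \<open>j\<close> of \<open>B\<close> combines exactly columns \<open>j\<close> and \<open>j - 1\<close>
  of \<open>A\<close> into the unit vector \<open>e\<^sub>j\<close>. So the nonzero entries of \<open>B\<close> are those at \<open>(j, j)\<close> and at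
  \<open>(j - 1, j)\<close>, indices taken cyclically, which is the bdsw pattern
  (\<open>cyclic_columns_imp_bdsw\<close>, \<open>bdsw_imp_cyclic_columns\<close>).

  Read in \<open>A\<close> itself, it says that row \<open>i\<close> arises from its diagonal entry: walking cyclically to the
  right from \<open>(i, i)\<close>, one multiplies by \<open>c (i + 1)\<close>, \<open>c (i + 2)\<close>, and so on, until the row is used
  up. A nonsingular matrix has no zero row, hence \<open>A\<close> is full; and the quotient of the entries of a
  row at two places of the walk is a product of factors \<open>c l\<close> that does not depend on the row. The
  inverse cyclic identities state this independence (\<open>cyclic_columns_imp_full_inverse_cyclic\<close>),
  and they suffice to recover the factors (\<open>full_inverse_cyclic_imp_cyclic_columns\<close>).
\<close>

section \<open>Cyclically proportional columns\<close>

definition cyc_pred :: "nat \<Rightarrow> nat \<Rightarrow> nat" where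
  "cyc_pred n j = (if j = 0 then n - 1 else j - 1)"

definition cyclic_columns :: "nat \<Rightarrow> (nat \<Rightarrow> 'a::field) \<Rightarrow> 'a mat \<Rightarrow> bool" where
  "cyclic_columns n c A \<longleftrightarrow>
     (\<forall>j<n. c j \<noteq> 0 \<and> (\<forall>i<n. i \<noteq> j \<longrightarrow> A $$ (i, j) = c j * A $$ (i, cyc_pred n j)))"

lemma cyc_pred_less: "j < n \<Longrightarrow> cyc_pred n j < n"
  by (auto simp: cyc_pred_def)

lemma cyc_pred_neq: "n \<ge> 2 \<Longrightarrow> cyc_pred n j \<noteq> j"
  by (auto simp: cyc_pred_def)

lemma bdsw_iff_nonzero_pattern:
  assumes n: "n \<ge> 2" and B: "B \<in> carrier_mat n n"
  shows "bdsw n B \<longleftrightarrow> (\<forall>i<n. \<forall>j<n. B $$ (i, j) \<noteq> 0 \<longleftrightarrow> i = j \<or> i = cyc_pred n j)"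
proof
  assume b: "bdsw n B"
  show "\<forall>i<n. \<forall>j<n. B $$ (i, j) \<noteq> 0 \<longleftrightarrow> i = j \<or> i = cyc_pred n j"
  proof (intro allI impI)
    fix i j assume ij: "i < n" "j < n"
    consider "i = j" | "j = i + 1" | "i = n - 1" "j = 0"
      | "i \<noteq> j" "j \<noteq> i + 1" "(i, j) \<noteq> (n - 1, 0)" by blast
    then show "B $$ (i, j) \<noteq> 0 \<longleftrightarrow> i = j \<or> i = cyc_pred n j"
      by cases (use b ij in \<open>auto simp: bdsw_def cyc_pred_def\<close>)
  qed
next
  assume p: "\<forall>i<n. \<forall>j<n. B $$ (i, j) \<noteq> 0 \<longleftrightarrow> i = j \<or> i = cyc_pred n j"
  show "bdsw n B"
    unfolding bdsw_def
  proof (intro conjI allI impI B)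
    show "B $$ (i, i) \<noteq> 0" if "i < n" for i using p that by blast
    show "B $$ (i, i + 1) \<noteq> 0" if "i + 1 < n" for i
      using p that by (simp add: cyc_pred_def)
    show "B $$ (n - 1, 0) \<noteq> 0"
      using p n by (simp add: cyc_pred_def)
    fix i j assume "i < n" "j < n" "i \<noteq> j \<and> j \<noteq> i + 1 \<and> (i, j) \<noteq> (n - 1, 0)"
    moreover from this have "i \<noteq> cyc_pred n j" by (auto simp: cyc_pred_def)
    ultimately show "B $$ (i, j) = 0" using p by blast
  qed
qed

lemma mult_mat_entry:
  assumes "A \<in> carrier_mat n n" "B \<in> carrier_mat n n" "i < n" "j < n"
  shows "(A * B) $$ (i, j) = (\<Sum>k<n. A $$ (i, k) * B $$ (k, j))"
  using assms by (auto simp: scalar_prod_def atLeast0LessThan intro!: sum.cong)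

section \<open>Bi-diagonal south-west inverses\<close>

text \<open>
  Column \<open>j\<close> of \<open>A * B = 1\<close> has only two summands in each row. Outside of row \<open>j\<close> they cancel,
  which gives the factor \<open>c j = - B $$ (j - 1, j) / B $$ (j, j)\<close>.
\<close>

lemma bdsw_imp_cyclic_columns:
  assumes n: "n \<ge> 2" and A: "A \<in> carrier_mat n n" and b: "bdsw n B" and AB: "A * B = 1\<^sub>m n"
  shows "cyclic_columns n (\<lambda>j. - B $$ (cyc_pred n j, j) / B $$ (j, j)) A"
  unfolding cyclic_columns_def
proof (intro allI impI conjI)
  have B: "B \<in> carrier_mat n n" using b by (simp add: bdsw_def)
  note pat = bdsw_iff_nonzero_pattern[OF n B, THEN iffD1, OF b, rule_format]
  fix j assume j: "j < n"
  let ?p = "cyc_pred n j"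
  have p: "?p < n" "?p \<noteq> j" using cyc_pred_less[OF j] cyc_pred_neq[OF n] by auto
  have nz: "B $$ (?p, j) \<noteq> 0" "B $$ (j, j) \<noteq> 0" using pat j p by auto
  then show "- B $$ (?p, j) / B $$ (j, j) \<noteq> 0" by simp
  fix i assume i: "i < n" "i \<noteq> j"
  have "0 = (\<Sum>k<n. A $$ (i, k) * B $$ (k, j))"
    using mult_mat_entry[OF A B i(1) j] AB i j by simp
  also have "\<dots> = (\<Sum>k\<in>{?p, j}. A $$ (i, k) * B $$ (k, j))"
    using pat[OF _ j] p j by (intro sum.mono_neutral_right) auto
  also have "\<dots> = A $$ (i, ?p) * B $$ (?p, j) + A $$ (i, j) * B $$ (j, j)"
    using p by simp
  finally show "A $$ (i, j) = - B $$ (?p, j) / B $$ (j, j) * A $$ (i, ?p)"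
    using nz by (simp add: field_simps)
qed

text \<open>
  The combination of columns \<open>j\<close> and \<open>j - 1\<close> of \<open>A\<close> with coefficients \<open>1\<close> and \<open>- c j\<close> is
  \<open>d\<close> times the unit vector \<open>e\<^sub>j\<close>. Multiplication by \<open>B\<close> from the left turns it into \<open>d\<close> times column
  \<open>j\<close> of \<open>B\<close>, and on the other hand into the vector with entries \<open>1\<close> and \<open>- c j\<close> at the places \<open>j\<close>
  and \<open>j - 1\<close>. The entry at place \<open>j\<close> shows that \<open>d\<close> is nonzero.
\<close>

lemma cyclic_columns_imp_bdsw:
  assumes n: "n \<ge> 2" and A: "A \<in> carrier_mat n n" and B: "B \<in> carrier_mat n n"
    and BA: "B * A = 1\<^sub>m n" and cyc: "cyclic_columns n c A"
  shows "bdsw n B"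
  unfolding bdsw_iff_nonzero_pattern[OF n B]
proof (intro allI impI)
  fix k j assume k: "k < n" and j: "j < n"
  let ?p = "cyc_pred n j"
  define d where "d = A $$ (j, j) - c j * A $$ (j, ?p)"
  have p: "?p < n" "?p \<noteq> j" using cyc_pred_less[OF j] cyc_pred_neq[OF n] by auto
  have c: "c j \<noteq> 0" and
    cols: "A $$ (i, j) - c j * A $$ (i, ?p) = (if i = j then d else 0)" if "i < n" for i
    using cyc j that by (auto simp: cyclic_columns_def d_def)
  have col: "B $$ (l, j) * d = (if l = j then 1 else 0) - c j * (if l = ?p then 1 else 0)"
    if l: "l < n" for l
  proof -
    have "(if l = j then 1 else 0) - c j * (if l = ?p then 1 else 0)
        = (\<Sum>i<n. B $$ (l, i) * A $$ (i, j)) - c j * (\<Sum>i<n. B $$ (l, i) * A $$ (i, ?p))"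
      using mult_mat_entry[OF B A l j] mult_mat_entry[OF B A l p(1)] BA l j p by simp
    also have "\<dots> = (\<Sum>i<n. B $$ (l, i) * (A $$ (i, j) - c j * A $$ (i, ?p)))"
      by (simp add: sum_distrib_left sum_subtractf algebra_simps)
    also have "\<dots> = (\<Sum>i<n. if i = j then B $$ (l, j) * d else 0)"
      by (intro sum.cong) (auto simp: cols)
    also have "\<dots> = B $$ (l, j) * d" using j by simp
    finally show ?thesis by simp
  qed
  have "d \<noteq> 0" using col[OF j] p by auto
  then have "B $$ (k, j) \<noteq> 0 \<longleftrightarrow> B $$ (k, j) * d \<noteq> 0" by simp
  also have "\<dots> \<longleftrightarrow> k = j \<or> k = ?p" using col[OF k] c[OF j] p by auto
  finally show "B $$ (k, j) \<noteq> 0 \<longleftrightarrow> k = j \<or> k = ?p" .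
qed

section \<open>Inverse cyclic matrices\<close>

text \<open>
  The part of the walk along row \<open>i\<close> between two columns \<open>k \<le> j\<close>. Entering column \<open>i\<close> from the
  left is the only step of row \<open>i\<close> that is not governed by \<open>c\<close>.
\<close>

lemma cyclic_columns_walk:
  assumes cyc: "cyclic_columns n c A" and i: "i < n" and "k \<le> j" "j < n" "i \<le> k \<or> j < i"
  shows "A $$ (i, j) = A $$ (i, k) * (\<Prod>l\<in>{k<..j}. c l)"
  using assms(3-)
proof (induction j rule: dec_induct)
  case base
  then show ?case by simp
next
  case (step j)
  have "A $$ (i, Suc j) = c (Suc j) * A $$ (i, j)"
    using cyc i step by (auto simp: cyclic_columns_def cyc_pred_def)
  moreover have "{k<..Suc j} = insert (Suc j) {k<..j}" using step by auto
  ultimately show ?case using step by auto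
qed

lemma cyclic_columns_wrap:
  assumes "cyclic_columns n c A" "0 < i" "i < n"
  shows "A $$ (i, 0) = c 0 * A $$ (i, n - 1)"
  using assms by (auto simp: cyclic_columns_def cyc_pred_def)

text \<open>
  If one entry of row \<open>i\<close> vanished, so would the diagonal entry, from which the walk starts, and with
  it the whole row; but the product of row \<open>i\<close> of \<open>A\<close> with column \<open>i\<close> of \<open>B\<close> is \<open>1\<close>.
  The inverse cyclic identities compare two rows \<open>i\<close> and \<open>k\<close> over the walk from column \<open>k\<close> to
  column \<open>j\<close>.
\<close>

lemma cyclic_columns_imp_full_inverse_cyclic:
  fixes A :: "real mat"
  assumes A: "A \<in> carrier_mat n n" and B: "B \<in> carrier_mat n n" and AB: "A * B = 1\<^sub>m n"
    and cyc: "cyclic_columns n c A"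
  shows "full_matrix n A \<and> inverse_cyclic n A"
proof -
  note walk = cyclic_columns_walk[OF cyc] and wrap = cyclic_columns_wrap[OF cyc]
  have c: "c j \<noteq> 0" if "j < n" for j using cyc that by (simp add: cyclic_columns_def)
  have diag_multiple: "\<exists>q. q \<noteq> 0 \<and> A $$ (i, j) = A $$ (i, i) * q" if ij: "i < n" "j < n" for i j
  proof (cases "i \<le> j")
    case True
    then show ?thesis using walk[of i i j] c ij by (intro exI[of _ "\<Prod>l\<in>{i<..j}. c l"]) auto
  next
    case False
    have "A $$ (i, j) = A $$ (i, 0) * (\<Prod>l\<in>{0<..j}. c l)"
      using walk[of i 0 j] ij False by simp
    moreover have "A $$ (i, 0) = c 0 * A $$ (i, n - 1)" using wrap ij False by simp
    moreover have "A $$ (i, n - 1) = A $$ (i, i) * (\<Prod>l\<in>{i<..n - 1}. c l)"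
      using walk[of i i "n - 1"] ij by simp
    ultimately show ?thesis using c ij
      by (intro exI[of _ "(\<Prod>l\<in>{i<..n - 1}. c l) * c 0 * (\<Prod>l\<in>{0<..j}. c l)"]) auto
  qed
  have diag: "A $$ (i, i) \<noteq> 0" if i: "i < n" for i
  proof
    assume "A $$ (i, i) = 0"
    then have "A $$ (i, k) = 0" if "k < n" for k using diag_multiple[OF i that] by auto
    then have "(A * B) $$ (i, i) = 0" using mult_mat_entry[OF A B i i] by simp
    then show False using AB i by simp
  qed
  have "full_matrix n A"
    unfolding full_matrix_def using A diag diag_multiple by (metis mult_eq_0_iff)
  moreover have "inverse_cyclic n A"
    unfolding inverse_cyclic_def
  proof (intro conjI allI impI A diag)
    fix i k j assume "i < k \<and> k < j \<and> j < n"
    then show "A $$ (i, j) = A $$ (i, k) * A $$ (k, j) / A $$ (k, k)"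
      using walk[of i k j] walk[of k k j] diag[of k] by simp
  next
    fix i j assume h: "j < i \<and> i < n \<and> i \<noteq> n - 1"
    have "A $$ (r, j) = c 0 * A $$ (r, n - 1) * (\<Prod>l\<in>{0<..j}. c l)" if "j < r" "r < n" for r
      using walk[of r 0 j] wrap[of r] that by simp
    then have "A $$ (i, j) = c 0 * A $$ (i, n - 1) * (\<Prod>l\<in>{0<..j}. c l)"
      and "A $$ (n - 1, j) = c 0 * A $$ (n - 1, n - 1) * (\<Prod>l\<in>{0<..j}. c l)"
      using h by auto
    then show "A $$ (i, j) = A $$ (i, n - 1) * A $$ (n - 1, j) / A $$ (n - 1, n - 1)"
      using h diag[of "n - 1"] by simp
  next
    fix j assume "j < n - 1"
    then show "A $$ (n - 1, j) = A $$ (n - 1, 0) * A $$ (0, j) / A $$ (0, 0)"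
      using walk[of "n - 1" 0 j] walk[of 0 0 j] diag[of 0] by simp
  qed
  ultimately show ?thesis by simp
qed

text \<open>
  The factor \<open>c j\<close> has to be the quotient of the entries at columns \<open>j\<close> and \<open>j - 1\<close> in every row
  except \<open>j\<close>, so it can be read off in the row that cyclically precedes \<open>j\<close>. For \<open>j = 0\<close> this is the
  last row, to which the second identity reduces row \<open>i\<close>. For \<open>j > 0\<close> it is row \<open>j - 1\<close>, and the
  first identity reduces the rows \<open>i < j\<close> to it. For \<open>i > j > 0\<close> the second identity leads from
  row \<open>i\<close> to the last row, and the third one from there to row \<open>0\<close>, where \<open>0 < j\<close>.
\<close>

lemma full_inverse_cyclic_imp_cyclic_columns:
  assumes n: "n \<ge> 2" and full: "full_matrix n A" and ic: "inverse_cyclic n A"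
  shows "cyclic_columns n (\<lambda>j. A $$ (cyc_pred n j, j) / A $$ (cyc_pred n j, cyc_pred n j)) A"
  unfolding cyclic_columns_def
proof (intro allI impI conjI)
  have nz: "A $$ (i, j) \<noteq> 0" if "i < n" "j < n" for i j
    using full that by (simp add: full_matrix_def)
  have upper: "A $$ (i, j) = A $$ (i, k) * A $$ (k, j) / A $$ (k, k)" if "i < k" "k < j" "j < n" for i k j
    using ic that unfolding inverse_cyclic_def by blast
  have lower: "A $$ (i, j) = A $$ (i, n - 1) * A $$ (n - 1, j) / A $$ (n - 1, n - 1)"
    if "j < i" "i < n" "i \<noteq> n - 1" for i j
    using ic that unfolding inverse_cyclic_def by blast
  have last: "A $$ (n - 1, j) = A $$ (n - 1, 0) * A $$ (0, j) / A $$ (0, 0)" if "j < n - 1" for j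
    using ic that unfolding inverse_cyclic_def by blast
  fix j assume j: "j < n"
  let ?p = "cyc_pred n j"
  let ?c = "A $$ (?p, j) / A $$ (?p, ?p)"
  have p: "?p < n" using cyc_pred_less[OF j] .
  show "?c \<noteq> 0" using nz j p by simp
  fix i assume i: "i < n" "i \<noteq> j"
  show "A $$ (i, j) = ?c * A $$ (i, ?p)"
  proof (cases "j = 0")
    case True
    then have pj: "?p = n - 1" by (simp add: cyc_pred_def)
    show ?thesis
    proof (cases "i = n - 1")
      case True
      then show ?thesis using nz[OF p p] pj by simp
    next
      case False
      then show ?thesis using lower[of j i] i True pj by simp
    qed
  next
    case False
    then have pj: "?p = j - 1" by (simp add: cyc_pred_def)
    have above: "A $$ (r, j) = ?c * A $$ (r, ?p)" if "r < j" for r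
    proof (cases "r = j - 1")
      case True
      then show ?thesis using nz[OF p p] pj by simp
    next
      case False
      then show ?thesis using upper[of r ?p j] that j pj by simp
    qed
    have bottom: "A $$ (n - 1, j) = ?c * A $$ (n - 1, ?p)" if "j < n - 1"
    proof -
      have "A $$ (n - 1, ?p) = A $$ (n - 1, 0) * A $$ (0, ?p) / A $$ (0, 0)"
        by (rule last) (use that pj in simp)
      then show ?thesis using last[OF that] above[of 0] False by simp
    qed
    consider "i < j" | "j < i" "i = n - 1" | "j < i" "i \<noteq> n - 1" using i by linarith
    then show ?thesis
    proof cases
      case 3
      have "A $$ (i, j) = A $$ (i, n - 1) * A $$ (n - 1, j) / A $$ (n - 1, n - 1)"
        using lower 3 i by blast
      moreover have "A $$ (i, ?p) = A $$ (i, n - 1) * A $$ (n - 1, ?p) / A $$ (n - 1, n - 1)"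
        by (rule lower) (use 3 i pj in auto)
      ultimately show ?thesis using bottom 3 i by simp
    qed (use above bottom in auto)
  qed
qed

section \<open>The characterization of nonsingular full inverse cyclic matrices\<close>

lemma mat_inverse_of_invertible:
  fixes A :: "'a::field mat"
  assumes A: "A \<in> carrier_mat n n" and inv: "invertible_mat A"
  shows "the (mat_inverse A) \<in> carrier_mat n n"
    and "A * the (mat_inverse A) = 1\<^sub>m n" and "the (mat_inverse A) * A = 1\<^sub>m n"
proof -
  obtain C where AC: "A * C = 1\<^sub>m n" and CA: "C * A = 1\<^sub>m (dim_row C)"
    using inv A by (auto simp: invertible_mat_def inverts_mat_def)
  have "dim_col (A * C) = n" "dim_col (C * A) = dim_row C" by (simp_all add: AC CA)
  then have C: "C \<in> carrier_mat n n" using A by auto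
  then have "A \<in> Units (ring_mat TYPE('a) n ())"
    using A AC CA by (auto simp: Units_def ring_mat_def)
  then obtain B where "mat_inverse A = Some B"
    using mat_inverse(1)[OF A, of "()"] by (cases "mat_inverse A") auto
  then show "the (mat_inverse A) \<in> carrier_mat n n"
    "A * the (mat_inverse A) = 1\<^sub>m n" "the (mat_inverse A) * A = 1\<^sub>m n"
    using mat_inverse(2)[OF A] by auto
qed

theorem theorem2p11:
  fixes n :: nat and A :: "real mat"
  assumes "n \<ge> 2"
    and "A \<in> carrier_mat n n"
    and "invertible_mat A"
  shows "full_matrix n A \<and> inverse_cyclic n A \<longleftrightarrow> bdsw n (the (mat_inverse A))"
proof -
  note inverse = mat_inverse_of_invertible[OF assms(2,3)]
  show ?thesis
    using full_inverse_cyclic_imp_cyclic_columns[OF assms(1)]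
      cyclic_columns_imp_full_inverse_cyclic[OF assms(2) inverse(1,2)]
      cyclic_columns_imp_bdsw[OF assms(1,2) inverse(1,3)]
      bdsw_imp_cyclic_columns[OF assms(1,2) _ inverse(2)]
    by blast
qed

end
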